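(* Let $\{a_n\}_{n\in\mathbb{N}}\subset\mathbb{H}$ and suppose $\limsup_{n\to+\infty}|a_n|^{1/n}=1/R$ for some $R>0$. Let $q_0=x_0+Iy_0\in\mathbb{H}$ with $x_0\in\mathbb{R}$, $y_0>0$, $I\in\mathbb{S}$, and set $P_{2n}(q)=[(q-x_0)^2+y_0^2]^n$ and $P_{2n+1}(q)=[(q-x_0)^2+y_0^2]^n(q-q_0)$ for all $n\in\mathbb{N}$. Then the function series $\sum_{n\in\mathbb{N}}P_n(q)a_n$ converges absolutely and uniformly on compact sets in $$U(x_0+y_0\mathbb{S},R)=\{q\in\mathbb{H}:|(q-x_0)^2+y_0^2|<R^2\},$$ where it defines a (slice) regular function. Furthermore, the series diverges at every $q\in\mathbb{H}\setminus\overline{U(x_0+y_0\mathbb{S},R)}$.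
   Context: $\mathbb{H}$ denotes the real algebra of quaternions, with modulus $|\cdot|$; $\mathbb{N}=\{0,1,2,\dots\}$; $\mathbb{S}=\{q\in\mathbb{H}:q^2=-1\}$ is the 2-sphere of imaginary units; $x_0+y_0\mathbb{S}=\{x_0+y_0J:J\in\mathbb{S}\}$. For $I\in\mathbb{S}$ let $L_I=\mathbb{R}+I\mathbb{R}$ (identified with $\mathbb{C}$). For an open set $\Omega\subseteq\mathbb{H}$ and $f:\Omega\to\mathbb{H}$, put $\Omega_I=\Omega\cap L_I$ and $f_I=f|_{\Omega_I}$. The function $f$ is called (slice) regular if for every $I\in\mathbb{S}$ the restriction $f_I$ is holomorphic, i.e. $\frac12\left(\frac{\partial}{\partial x}+I\frac{\partial}{\partial y}\right)f_I(x+Iy)=0$ identically on $\Omega_I$. *)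

theory Defs
  imports "HOL-Analysis.Analysis"
begin

section \<open>The real algebra of quaternions\<close>

codatatype quat = Quat (Re0: real) (Im1: real) (Im2: real) (Im3: real)

lemma quat_eq_iff:
  "p = q \<longleftrightarrow> Re0 p = Re0 q \<and> Im1 p = Im1 q \<and> Im2 p = Im2 q \<and> Im3 p = Im3 q"
  by (auto intro: quat.expand)

instantiation quat :: ab_group_add
begin

primcorec zero_quat where
  "Re0 0 = 0"
| "Im1 0 = 0"
| "Im2 0 = 0"
| "Im3 0 = 0"

primcorec plus_quat where
  "Re0 (p + q) = Re0 p + Re0 q"
| "Im1 (p + q) = Im1 p + Im1 q"
| "Im2 (p + q) = Im2 p + Im2 q"
| "Im3 (p + q) = Im3 p + Im3 q"

primcorec uminus_quat where
  "Re0 (- q) = - Re0 q"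
| "Im1 (- q) = - Im1 q"
| "Im2 (- q) = - Im2 q"
| "Im3 (- q) = - Im3 q"

primcorec minus_quat where
  "Re0 (p - q) = Re0 p - Re0 q"
| "Im1 (p - q) = Im1 p - Im1 q"
| "Im2 (p - q) = Im2 p - Im2 q"
| "Im3 (p - q) = Im3 p - Im3 q"

instance
  by standard (simp_all add: quat_eq_iff)

end

instantiation quat :: ring_1
begin

primcorec one_quat where
  "Re0 1 = 1"
| "Im1 1 = 0"
| "Im2 1 = 0"
| "Im3 1 = 0"

primcorec times_quat where
  "Re0 (p * q) = Re0 p * Re0 q - Im1 p * Im1 q - Im2 p * Im2 q - Im3 p * Im3 q"
| "Im1 (p * q) = Re0 p * Im1 q + Im1 p * Re0 q + Im2 p * Im3 q - Im3 p * Im2 q"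
| "Im2 (p * q) = Re0 p * Im2 q - Im1 p * Im3 q + Im2 p * Re0 q + Im3 p * Im1 q"
| "Im3 (p * q) = Re0 p * Im3 q + Im1 p * Im2 q - Im2 p * Im1 q + Im3 p * Re0 q"

instance
  by standard (simp_all add: quat_eq_iff algebra_simps)

end

instantiation quat :: real_algebra_1
begin

primcorec scaleR_quat where
  "Re0 (r *\<^sub>R q) = r * Re0 q"
| "Im1 (r *\<^sub>R q) = r * Im1 q"
| "Im2 (r *\<^sub>R q) = r * Im2 q"
| "Im3 (r *\<^sub>R q) = r * Im3 q"

instance
  by standard (simp_all add: quat_eq_iff algebra_simps)

end

lemma quat_sum_squares_eq_0:
  "(Re0 q)\<^sup>2 + (Im1 q)\<^sup>2 + (Im2 q)\<^sup>2 + (Im3 q)\<^sup>2 = 0 \<longleftrightarrow> q = 0"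
  by (simp add: quat_eq_iff add_nonneg_eq_0_iff)

instantiation quat :: real_inner
begin

definition "inner p q = Re0 p * Re0 q + Im1 p * Im1 q + Im2 p * Im2 q + Im3 p * Im3 q"
  for p q :: quat

definition "norm q = sqrt ((Re0 q)\<^sup>2 + (Im1 q)\<^sup>2 + (Im2 q)\<^sup>2 + (Im3 q)\<^sup>2)"
  for q :: quat

definition sgn_quat_def: "sgn q = q /\<^sub>R norm q" for q :: quat

definition dist_quat_def: "dist p q = norm (p - q)" for p q :: quat

definition uniformity_quat_def:
  "(uniformity :: (quat \<times> quat) filter) = (INF e\<in>{0 <..}. principal {(p, q). dist p q < e})"

definition open_quat_def:
  "open (U :: quat set) \<longleftrightarrow> (\<forall>p\<in>U. eventually (\<lambda>(p', q). p' = p \<longrightarrow> q \<in> U) uniformity)"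

instance
proof
  fix p q r :: quat and c :: real
  show "inner p q = inner q p"
    by (simp add: inner_quat_def mult.commute)
  show "inner (p + q) r = inner p r + inner q r"
    by (simp add: inner_quat_def algebra_simps)
  show "inner (c *\<^sub>R p) q = c * inner p q"
    by (simp add: inner_quat_def algebra_simps)
  show "0 \<le> inner p p"
    by (simp add: inner_quat_def)
  show "inner p p = 0 \<longleftrightarrow> p = 0"
    using quat_sum_squares_eq_0[of p] by (simp add: inner_quat_def power2_eq_square)
  show "norm p = sqrt (inner p p)"
    by (simp add: inner_quat_def norm_quat_def power2_eq_square)
qed (rule sgn_quat_def dist_quat_def open_quat_def uniformity_quat_def)+

end

instantiation quat :: real_normed_div_algebra
begin

definition "inverse q =
  Quat (Re0 q) (- Im1 q) (- Im2 q) (- Im3 q)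
    /\<^sub>R ((Re0 q)\<^sup>2 + (Im1 q)\<^sup>2 + (Im2 q)\<^sup>2 + (Im3 q)\<^sup>2)"
  for q :: quat

definition "p div q = p * inverse q" for p q :: quat

instance
proof
  fix p q :: quat
  show "inverse p * p = 1" if "p \<noteq> 0"
  proof -
    have "(Re0 p)\<^sup>2 + (Im1 p)\<^sup>2 + (Im2 p)\<^sup>2 + (Im3 p)\<^sup>2 \<noteq> 0"
      using that by (simp only: quat_sum_squares_eq_0 not_False_eq_True)
    then show ?thesis
      by (simp add: inverse_quat_def quat_eq_iff divide_simps) (simp add: power2_eq_square algebra_simps)
  qed
  show "p * inverse p = 1" if "p \<noteq> 0"
  proof -
    have "(Re0 p)\<^sup>2 + (Im1 p)\<^sup>2 + (Im2 p)\<^sup>2 + (Im3 p)\<^sup>2 \<noteq> 0"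
      using that by (simp only: quat_sum_squares_eq_0 not_False_eq_True)
    then show ?thesis
      by (simp add: inverse_quat_def quat_eq_iff divide_simps) (simp add: power2_eq_square algebra_simps)
  qed
  show "p div q = p * inverse q"
    by (rule divide_quat_def)
  show "inverse (0 :: quat) = 0"
    by (simp add: inverse_quat_def quat_eq_iff)
  show "norm (p * q) = norm p * norm q"
    unfolding norm_quat_def real_sqrt_mult[symmetric]
    by (rule arg_cong[of _ _ sqrt]) (simp add: power2_eq_square algebra_simps)
qed

end

section \<open>Slice regular functions\<close>

definition imaginary_units :: "quat set" where
  "imaginary_units = {q. q\<^sup>2 = -1}"

text \<open>
  \<^term>\<open>f\<close> restricted to the part of \<^term>\<open>\<Omega>\<close> lying in the complex line \<open>L\<^sub>I = \<real> + I\<real>\<close> is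
  holomorphic: as a function of the real coordinates \<open>(x, y)\<close> of \<open>x + I y\<close> it has continuous
  partial derivatives \<open>fx\<close>, \<open>fy\<close> (the \<open>C\<^sup>1\<close> assumption implicit in "holomorphic") and it
  satisfies the Cauchy-Riemann equation for left multiplication by \<open>I\<close>.
  Only the values of \<^term>\<open>f\<close> on \<open>\<Omega> \<inter> L\<^sub>I\<close>, which is open in \<open>L\<^sub>I\<close>, matter.
\<close>

definition slice_holomorphic_on :: "quat \<Rightarrow> quat set \<Rightarrow> (quat \<Rightarrow> quat) \<Rightarrow> bool" where
  "slice_holomorphic_on I \<Omega> f \<longleftrightarrow>
    (let D = {(x, y). of_real x + I * of_real y \<in> \<Omega>} :: (real \<times> real) set in
     \<exists>fx fy :: real \<times> real \<Rightarrow> quat.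
       continuous_on D fx \<and> continuous_on D fy \<and>
       (\<forall>(x, y)\<in>D.
          ((\<lambda>s. f (of_real s + I * of_real y)) has_vector_derivative fx (x, y)) (at x) \<and>
          ((\<lambda>t. f (of_real x + I * of_real t)) has_vector_derivative fy (x, y)) (at y) \<and>
          (1 / 2) *\<^sub>R (fx (x, y) + I * fy (x, y)) = 0))"

definition slice_regular_on :: "quat set \<Rightarrow> (quat \<Rightarrow> quat) \<Rightarrow> bool" where
  "slice_regular_on \<Omega> f \<longleftrightarrow>
    open \<Omega> \<and> (\<forall>I\<in>imaginary_units. slice_holomorphic_on I \<Omega> f)"

section \<open>Neighbourhoods of 2-spheres\<close>

text \<open>
  The set \<open>U(x\<^sub>0 + y\<^sub>0\<S>, R)\<close>; for \<open>y\<^sub>0 > 0\<close> the sphere \<open>x\<^sub>0 + y\<^sub>0\<S>\<close> determines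
  \<open>x\<^sub>0\<close> and \<open>y\<^sub>0\<close>.
\<close>

definition sphere_nbhd :: "real \<Rightarrow> real \<Rightarrow> real \<Rightarrow> quat set" where
  "sphere_nbhd x\<^sub>0 y\<^sub>0 R = {q. norm ((q - of_real x\<^sub>0)\<^sup>2 + (of_real y\<^sub>0)\<^sup>2) < R\<^sup>2}"

end

theory Submission
  imports Defs
begin

text \<open>
  Write \<open>w(q) = (q - x\<^sub>0)\<^sup>2 + y\<^sub>0\<^sup>2\<close>. The modulus of quaternions is multiplicative, so on a set
  where \<open>|w| \<le> r\<^sup>2\<close> and \<open>|q|\<close> is bounded, \<open>|P\<^sub>n(q)|\<close> is at most a constant times \<open>r\<^sup>n\<close>: the series
  behaves like an ordinary power series in \<open>|w|\<^bsup>1/2\<^esup>\<close>. By the root criterion \<open>\<Sum>(n+1) r\<^sup>n |a\<^sub>n|\<close>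
  converges for \<open>r < R\<close>, and it majorizes both the series and the series of formal derivatives
  (\<open>norm_terms_majorant\<close>). A compact subset of \<open>U\<close> has \<open>max |w| < R\<^sup>2\<close> and hence lies, together with
  a neighbourhood, in such a region (\<open>compact_majorant\<close>); the Weierstrass test gives absolute and
  uniform convergence.

  Regularity comes from differentiating term by term. Along a real line \<open>s \<mapsto> p + s d\<close> with
  \<open>p d = d p\<close>, the derivative of \<open>P\<^sub>n\<close> is \<open>d\<close> times a formal derivative \<open>P\<^sub>n'\<close> that does not depend on
  \<open>d\<close>. The factor \<open>d\<close> stands on the left because it commutes with the points of the line, but perhaps
  not with \<open>q\<^sub>0\<close> or the coefficients. Summing term by term, the derivative of the sum \<open>f\<close> is
  \<open>d f'\<close> (\<open>series_has_vector_derivative\<close>). In the slice \<open>\<real> + J\<real>\<close> the directions \<open>1\<close> and \<open>J\<close> give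
  the partial derivatives \<open>f'\<close> and \<open>J f'\<close>, and \<open>f' + J (J f') = 0\<close> is the Cauchy-Riemann equation.

  For divergence, \<open>|w(q)| > R\<^sup>2\<close> outside the closure of \<open>U\<close>: a point with \<open>|w(q)| = R\<^sup>2\<close> is a limit of
  points of \<open>U\<close>, because \<open>|w|\<close> has no local minimum other than its zeros
  (\<open>norm_sphere_poly_decreases_nearby\<close>). With \<open>r = |w(q)|\<^bsup>1/2\<^esup> > R\<close> one has \<open>|P\<^sub>n(q)| \<ge> c r\<^sup>n\<close> for some
  \<open>c > 0\<close>, so terms tending to zero would force \<open>limsup |a\<^sub>n|\<^bsup>1/n\<^esup> \<le> 1/r < 1/R\<close>.
\<close>

section \<open>Completeness of the quaternions\<close>

lemma bounded_linear_quat_components: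
  "bounded_linear Re0" "bounded_linear Im1" "bounded_linear Im2" "bounded_linear Im3"
  by (rule bounded_linear_intro[where K = 1];
      simp add: norm_quat_def; rule real_le_rsqrt; simp)+

lemma quat_eq_basis_expansion:
  "q = Re0 q *\<^sub>R 1 + Im1 q *\<^sub>R Quat 0 1 0 0 + Im2 q *\<^sub>R Quat 0 0 1 0 + Im3 q *\<^sub>R Quat 0 0 0 1"
  by (simp add: quat_eq_iff)

instance quat :: banach
proof
  fix X :: "nat \<Rightarrow> quat"
  assume X: "Cauchy X"
  have "convergent (\<lambda>n. Re0 (X n))" "convergent (\<lambda>n. Im1 (X n))"
    "convergent (\<lambda>n. Im2 (X n))" "convergent (\<lambda>n. Im3 (X n))"
    using bounded_linear_quat_components[THEN bounded_linear.Cauchy, OF X]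
    by (simp_all add: Cauchy_convergent_iff)
  then obtain r i j k where "(\<lambda>n. Re0 (X n)) \<longlonglongrightarrow> r" "(\<lambda>n. Im1 (X n)) \<longlonglongrightarrow> i"
    "(\<lambda>n. Im2 (X n)) \<longlonglongrightarrow> j" "(\<lambda>n. Im3 (X n)) \<longlonglongrightarrow> k"
    by (auto simp: convergent_def)
  then have "(\<lambda>n. Re0 (X n) *\<^sub>R 1 + Im1 (X n) *\<^sub>R Quat 0 1 0 0 + Im2 (X n) *\<^sub>R Quat 0 0 1 0
      + Im3 (X n) *\<^sub>R Quat 0 0 0 1)
    \<longlonglongrightarrow> r *\<^sub>R 1 + i *\<^sub>R Quat 0 1 0 0 + j *\<^sub>R Quat 0 0 1 0 + k *\<^sub>R Quat 0 0 0 1"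
    by (intro tendsto_intros)
  then have "X \<longlonglongrightarrow> r *\<^sub>R 1 + i *\<^sub>R Quat 0 1 0 0 + j *\<^sub>R Quat 0 0 1 0 + k *\<^sub>R Quat 0 0 0 1"
    by (simp only: quat_eq_basis_expansion[symmetric])
  then show "convergent X"
    by (rule convergentI)
qed

section \<open>Derivatives of series and powers, and the root criterion\<close>

text \<open>
  Weierstrass' test applied to the derivatives justifies differentiation under the sum.
\<close>

lemma has_vector_derivative_suminf_M_test:
  fixes f f' :: "nat \<Rightarrow> real \<Rightarrow> 'a::banach"
  assumes S: "open S" "convex S" "t \<in> S"
    and der: "\<And>n s. s \<in> S \<Longrightarrow> (f n has_vector_derivative f' n s) (at s)"
    and bound: "\<And>n s. s \<in> S \<Longrightarrow> norm (f' n s) \<le> M n" and M: "summable M"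
    and summable_f: "\<And>s. s \<in> S \<Longrightarrow> summable (\<lambda>n. f n s)"
  shows "((\<lambda>s. \<Sum>n. f n s) has_vector_derivative (\<Sum>n. f' n t)) (at t)"
proof -
  have unif: "uniform_limit S (\<lambda>n s. \<Sum>i<n. f' i s) (\<lambda>s. \<Sum>i. f' i s) sequentially"
    by (rule Weierstrass_m_test[OF bound M])
  have "\<exists>g. \<forall>s\<in>S. (\<lambda>n. f n s) sums g s \<and>
      (g has_derivative (\<lambda>h. h *\<^sub>R (\<Sum>i. f' i s))) (at s within S)"
  proof (rule has_derivative_series[where f' = "\<lambda>n s h. h *\<^sub>R f' n s"])
    show "(f n has_derivative (\<lambda>h. h *\<^sub>R f' n s)) (at s within S)" if "s \<in> S" for n s
      using der[OF that] by (auto simp: has_vector_derivative_def intro: has_derivative_at_withinI)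
    show "\<forall>\<^sub>F n in sequentially. \<forall>s\<in>S. \<forall>h. norm ((\<Sum>i<n. h *\<^sub>R f' i s) - h *\<^sub>R (\<Sum>i. f' i s))
        \<le> e * norm h" if "e > 0" for e
      using uniform_limitD[OF unif that]
    proof eventually_elim
      case (elim n)
      show ?case
      proof (intro ballI allI)
        fix s h assume "s \<in> S"
        then have "norm ((\<Sum>i<n. f' i s) - (\<Sum>i. f' i s)) \<le> e"
          using elim by (auto simp: dist_norm intro: less_imp_le)
        then have "\<bar>h\<bar> * norm ((\<Sum>i<n. f' i s) - (\<Sum>i. f' i s)) \<le> \<bar>h\<bar> * e"
          by (intro mult_left_mono) auto
        then show "norm ((\<Sum>i<n. h *\<^sub>R f' i s) - h *\<^sub>R (\<Sum>i. f' i s)) \<le> e * norm h"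
          by (simp add: scaleR_sum_right[symmetric] scaleR_diff_right[symmetric] mult.commute)
      qed
    qed
    show "(\<lambda>n. f n t) sums (\<Sum>n. f n t)"
      using summable_f S(3) by (simp add: summable_sums)
  qed (use S in auto)
  then obtain g where g: "\<forall>s\<in>S. (\<lambda>n. f n s) sums g s \<and>
      (g has_derivative (\<lambda>h. h *\<^sub>R (\<Sum>i. f' i s))) (at s within S)" ..
  have "((\<lambda>s. \<Sum>n. f n s) has_derivative (\<lambda>h. h *\<^sub>R (\<Sum>i. f' i t))) (at t within S)"
  proof (rule has_derivative_transform[OF S(3)])
    show "(\<Sum>n. f n s) = g s" if "s \<in> S" for s
      using g that sums_unique[of "\<lambda>n. f n s" "g s"] by simp
    show "(g has_derivative (\<lambda>h. h *\<^sub>R (\<Sum>i. f' i t))) (at t within S)"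
      using g S(3) by simp
  qed
  then show ?thesis
    unfolding has_vector_derivative_def at_within_open[OF S(3,1)] .
qed

lemma of_real_commute:
  fixes x :: "'a::real_algebra_1"
  shows "of_real r * x = x * of_real r"
  by (simp add: of_real_def)

text \<open>
  In a noncommutative algebra the product rule gives \<open>n\<close> different summands for the derivative of
  an \<open>n\<close>-th power; commutation of \<open>g t\<close> with its derivative makes them equal and lets the
  derivative be pulled out to the left.
\<close>

lemma has_vector_derivative_power_commuting:
  fixes g :: "real \<Rightarrow> 'a::real_normed_algebra_1"
  assumes g: "(g has_vector_derivative g') (at t)" and comm: "g t * g' = g' * g t"
  shows "((\<lambda>s. g s ^ n) has_vector_derivative g' * (of_nat n * g t ^ (n - 1))) (at t)"
proof (induction n)
  case (Suc n)
  have "((\<lambda>s. g s * g s ^ n) has_vector_derivative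
      g t * (g' * (of_nat n * g t ^ (n - 1))) + g' * g t ^ n) (at t)"
    by (rule has_vector_derivative_mult[OF g Suc])
  moreover have "g t * (g' * (of_nat n * g t ^ (n - 1))) = g' * (of_nat n * g t ^ n)"
  proof (cases n)
    case (Suc m)
    have "g t * (g' * (of_nat n * g t ^ m)) = g' * (g t * of_nat n * g t ^ m)"
      by (simp only: mult.assoc[symmetric] comm)
    also have "\<dots> = g' * (of_nat n * g t ^ Suc m)"
      by (simp add: mult.assoc mult_of_nat_commute[of n "g t", symmetric])
    finally show ?thesis using Suc by simp
  qed simp
  ultimately show ?case
    by (simp add: algebra_simps)
qed simp

text \<open>
  For \<open>r < s < R\<close> the hypothesis gives \<open>|a\<^sub>n| \<le> s\<^bsup>-n\<^esup>\<close> eventually, so the terms are dominated by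
  \<open>(n+1) (r/s)\<^sup>n\<close>. The factor \<open>n+1\<close> leaves room for the derivatives of the terms.
\<close>

lemma summable_Suc_power_norm_of_limsup_root:
  fixes a :: "nat \<Rightarrow> 'a::real_normed_vector"
  assumes lim: "limsup (\<lambda>n. ereal (root n (norm (a n)))) = ereal (1 / R)"
    and r: "0 < r" "r < R"
  shows "summable (\<lambda>n. real (Suc n) * r ^ n * norm (a n))"
proof -
  obtain s where s: "r < s" "s < R" using dense r by blast
  then have "1 / R < 1 / s" using r by (simp add: frac_less2)
  then have "limsup (\<lambda>n. ereal (root n (norm (a n)))) < ereal (1 / s)"
    by (simp add: lim)
  then have "\<forall>\<^sub>F n in sequentially. root n (norm (a n)) < 1 / s"
    using Limsup_lessD by fastforce
  then have ev: "\<forall>\<^sub>F n in sequentially.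
      norm (real (Suc n) * r ^ n * norm (a n)) \<le> real (Suc n) * (r / s) ^ n"
    using eventually_gt_at_top[of 0]
  proof eventually_elim
    case (elim n)
    have "norm (a n) = root n (norm (a n)) ^ n"
      using elim by simp
    also have "\<dots> \<le> (1 / s) ^ n"
      using elim by (intro power_mono) auto
    finally have "norm (a n) \<le> (1 / s) ^ n" .
    then have "real (Suc n) * r ^ n * norm (a n) \<le> real (Suc n) * r ^ n * (1 / s) ^ n"
      using r by (intro mult_left_mono) auto
    then show ?case
      using r by (simp add: power_divide abs_mult)
  qed
  have "norm (r / s) < 1" using r s by simp
  then have "summable (\<lambda>n. real (Suc n) * (r / s) ^ n)"
    using geometric_deriv_sums sums_summable by blast
  then show ?thesis
    by (rule summable_comparison_test_ev[OF ev])
qed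

section \<open>The basis polynomials and their majorants\<close>

locale spherical_series =
  fixes x\<^sub>0 y\<^sub>0 R :: real and q\<^sub>0 :: quat and a :: "nat \<Rightarrow> quat"
  assumes R_pos: "R > 0"
    and limsup_root: "limsup (\<lambda>n. ereal (root n (norm (a n)))) = ereal (1 / R)"
begin

definition sphere_poly :: "quat \<Rightarrow> quat" where
  "sphere_poly q = (q - of_real x\<^sub>0)\<^sup>2 + (of_real y\<^sub>0)\<^sup>2"

definition basis :: "nat \<Rightarrow> quat \<Rightarrow> quat" where
  "basis n q = sphere_poly q ^ (n div 2) * (if even n then 1 else q - q\<^sub>0)"

text \<open>
  The slice derivative of the basis polynomial. The factor \<open>q - q\<^sub>0\<close> stays on the right, since it need
  not commute with the direction of differentiation. For \<open>n < 2\<close> the exponent \<open>n div 2 - 1\<close> is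
  truncated to \<open>0\<close>, which is harmless because the coefficient \<open>n div 2\<close> vanishes.
\<close>

definition basis_deriv :: "nat \<Rightarrow> quat \<Rightarrow> quat" where
  "basis_deriv n q =
    (2 * (q - of_real x\<^sub>0)) * (of_nat (n div 2) * sphere_poly q ^ (n div 2 - 1))
      * (if even n then 1 else q - q\<^sub>0)
    + (if even n then 0 else sphere_poly q ^ (n div 2))"

abbreviation U :: "quat set" where "U \<equiv> sphere_nbhd x\<^sub>0 y\<^sub>0 R"

lemma U_eq: "U = {q. norm (sphere_poly q) < R\<^sup>2}"
  by (simp add: sphere_nbhd_def sphere_poly_def)

lemma sphere_poly_commute:
  assumes "(q - of_real x\<^sub>0) * d = d * (q - of_real x\<^sub>0)"
  shows "sphere_poly q * d = d * sphere_poly q"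
  using power_commuting_commutes[OF assms, of 2] of_real_commute[of "y\<^sub>0\<^sup>2" d]
  by (simp add: sphere_poly_def distrib_left distrib_right)

lemma continuous_on_sphere_poly [continuous_intros]:
  "continuous_on S g \<Longrightarrow> continuous_on S (\<lambda>x. sphere_poly (g x))"
  unfolding sphere_poly_def by (intro continuous_intros)

lemma continuous_on_basis_deriv: "continuous_on S (basis_deriv n)"
  unfolding basis_deriv_def by (cases "even n") (auto intro!: continuous_intros)

lemma open_U: "open U"
  unfolding U_eq by (intro open_Collect_less continuous_intros)

text \<open>
  Since \<open>d\<close> commutes with \<open>p\<close>, it commutes with \<open>q - x\<^sub>0\<close> and with the value of the sphere polynomial
  at every \<open>q = p + t d\<close>. The chain and product rules therefore work as in the commutative case, with all
  factors \<open>d\<close> moved to the left of \<open>q - q\<^sub>0\<close>.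
\<close>

lemma basis_has_vector_derivative:
  assumes comm: "p * d = d * p"
  shows "((\<lambda>s. basis n (p + s *\<^sub>R d)) has_vector_derivative d * basis_deriv n (p + t *\<^sub>R d)) (at t)"
proof -
  define z where "z = p + t *\<^sub>R d - of_real x\<^sub>0"
  have lin: "((\<lambda>s. p + s *\<^sub>R d - c) has_vector_derivative d) (at t)" for c
    by (auto intro!: derivative_eq_intros)
  have zd: "z * d = d * z"
    by (simp add: z_def algebra_simps comm scaleR_conv_of_real of_real_commute)
  have "((\<lambda>s. sphere_poly (p + s *\<^sub>R d)) has_vector_derivative d * (of_nat 2 * z ^ (2 - 1)) + 0) (at t)"
    unfolding sphere_poly_def z_def
    by (intro has_vector_derivative_add has_vector_derivative_const
        has_vector_derivative_power_commuting lin) (use zd z_def in simp)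
  then have dw: "((\<lambda>s. sphere_poly (p + s *\<^sub>R d)) has_vector_derivative d * (2 * z)) (at t)"
    by simp
  have wd: "sphere_poly (p + t *\<^sub>R d) * (d * (2 * z)) = d * (2 * z) * sphere_poly (p + t *\<^sub>R d)"
  proof (rule sphere_poly_commute, fold z_def)
    show "z * (d * (2 * z)) = d * (2 * z) * z"
      by (simp only: mult_2 distrib_left distrib_right mult.assoc[symmetric] zd)
  qed
  have pow: "((\<lambda>s. sphere_poly (p + s *\<^sub>R d) ^ k) has_vector_derivative
      d * (2 * z) * (of_nat k * sphere_poly (p + t *\<^sub>R d) ^ (k - 1))) (at t)" for k
    by (rule has_vector_derivative_power_commuting[OF dw wd])
  show ?thesis
  proof (cases "even n")
    case True
    then show ?thesis
      using pow[of "n div 2"] by (simp add: basis_def basis_deriv_def z_def mult.assoc)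
  next
    case False
    have dd: "sphere_poly (p + t *\<^sub>R d) ^ k * d = d * sphere_poly (p + t *\<^sub>R d) ^ k" for k
      by (rule power_commuting_commutes[OF sphere_poly_commute]) (use zd z_def in simp)
    show ?thesis
      using has_vector_derivative_mult[OF pow[of "n div 2"] lin[of q\<^sub>0]] False
      by (simp add: basis_def basis_deriv_def z_def dd algebra_simps)
  qed
qed

text \<open>
  The Weierstrass majorant. Each \<open>P\<^sub>n\<close> contains about \<open>n/2\<close> factors of modulus at most \<open>r\<^sup>2\<close>, so the
  region \<open>|w| \<le> r\<^sup>2\<close> plays the part of a disc of radius \<open>r\<close>; the remaining factors are
  bounded in terms of \<open>C\<close>.
\<close>

lemma norm_terms_majorant:
  assumes r: "0 < r" "r < R"
  obtains M where "summable M"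
    "\<And>n q. norm (sphere_poly q) \<le> r\<^sup>2 \<Longrightarrow> norm q \<le> C \<Longrightarrow> norm (basis n q * a n) \<le> M n"
    "\<And>n q. norm (sphere_poly q) \<le> r\<^sup>2 \<Longrightarrow> norm q \<le> C \<Longrightarrow> norm (basis_deriv n q * a n) \<le> M n"
proof -
  define E where "E = \<bar>C\<bar> + \<bar>x\<^sub>0\<bar> + norm q\<^sub>0"
  \<comment> \<open>\<open>E\<close> bounds \<open>|q - x\<^sub>0|\<close> and \<open>|q - q\<^sub>0|\<close>. The summands of \<open>B\<close> are the constants needed in the four
      cases, \<open>P\<^sub>n\<close> or its derivative with \<open>n\<close> even or odd; the powers of \<open>1/r\<close> make up for the
      missing factors in \<open>r\<^sup>n\<close>.\<close>
  define B where "B = 1 + E / r + E / r\<^sup>2 + E\<^sup>2 / r ^ 3 + 1 / r"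
  have E0: "E \<ge> 0" by (simp add: E_def)
  have B: "1 \<le> B" "E / r \<le> B" "E / r\<^sup>2 \<le> B" "E\<^sup>2 / r ^ 3 + 1 / r \<le> B"
    unfolding B_def using E0 r(1) by (auto simp: add_increasing add_increasing2)
  show ?thesis
  proof (rule that[of "\<lambda>n. B * (real (Suc n) * r ^ n * norm (a n))"])
    show "summable (\<lambda>n. B * (real (Suc n) * r ^ n * norm (a n)))"
      by (intro summable_mult summable_Suc_power_norm_of_limsup_root[OF limsup_root] r)
  next
    fix n :: nat and q assume wq: "norm (sphere_poly q) \<le> r\<^sup>2" and qC: "norm q \<le> C"
    have E: "norm (q - of_real x\<^sub>0) \<le> E" "norm (q - q\<^sub>0) \<le> E"
      using norm_triangle_ineq4[of q "of_real x\<^sub>0"] norm_triangle_ineq4[of q q\<^sub>0] qC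
        norm_ge_zero[of q\<^sub>0] abs_ge_self[of C]
      unfolding E_def norm_of_real by linarith+
    have pow: "norm (sphere_poly q) ^ k \<le> r ^ (2 * k)" for k
      using power_mono[OF wq, of k] by (simp add: power_mult)
    have kpow: "real k * norm (sphere_poly q) ^ (k - 1) \<le> real k * r ^ (2 * k) / r\<^sup>2" for k
    proof (cases k)
      case (Suc m)
      then show ?thesis using pow[of m] r by (simp add: power2_eq_square)
    qed simp
    obtain k where k: "n = 2 * k \<or> n = 2 * k + 1" by (meson oddE evenE)
    have kr: "0 \<le> real k * r ^ (2 * k)" "0 \<le> r ^ (2 * k)" using r by auto
    have "norm (basis n q) \<le> B * r ^ n"
      using k
    proof
      assume n: "n = 2 * k"
      have "norm (basis n q) \<le> 1 * r ^ n"
        using pow[of k] by (simp add: n basis_def norm_power)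
      also have "\<dots> \<le> B * r ^ n" using B r by (intro mult_right_mono) auto
      finally show ?thesis .
    next
      assume n: "n = 2 * k + 1"
      have "norm (basis n q) \<le> r ^ (2 * k) * E"
        using pow[of k] E r by (simp add: n basis_def norm_power norm_mult mult_mono)
      also have "\<dots> = (E / r) * r ^ n" using r by (simp add: n)
      also have "\<dots> \<le> B * r ^ n" using B r by (intro mult_right_mono) auto
      finally show ?thesis .
    qed
    also have "\<dots> \<le> B * (real (Suc n) * r ^ n)"
      using B r by (intro mult_left_mono) auto
    finally show "norm (basis n q * a n) \<le> B * (real (Suc n) * r ^ n * norm (a n))"
      unfolding norm_mult by (metis mult.assoc mult_right_mono norm_ge_zero)
    have lead: "norm (2 * (q - of_real x\<^sub>0) * (of_nat k * sphere_poly q ^ (k - 1)))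
        \<le> (2 * E) * (real k * r ^ (2 * k) / r\<^sup>2)"
      unfolding norm_mult norm_power norm_of_nat
      using E kpow[of k] E0 by (intro mult_mono) auto
    have "norm (basis_deriv n q) \<le> B * (real (Suc n) * r ^ n)"
      using k
    proof
      assume n: "n = 2 * k"
      have "norm (basis_deriv n q) \<le> (E / r\<^sup>2) * (real n * r ^ n)"
        using lead by (simp add: n basis_deriv_def algebra_simps)
      also have "\<dots> \<le> B * (real (Suc n) * r ^ n)"
        using B r by (intro mult_mono) auto
      finally show ?thesis .
    next
      assume n: "n = 2 * k + 1"
      have "norm (basis_deriv n q) \<le>
          norm (2 * (q - of_real x\<^sub>0) * (of_nat k * sphere_poly q ^ (k - 1))) * norm (q - q\<^sub>0)
          + norm (sphere_poly q) ^ k"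
        using norm_triangle_ineq[of "2 * (q - of_real x\<^sub>0) * (of_nat k * sphere_poly q ^ (k - 1)) * (q - q\<^sub>0)"
            "sphere_poly q ^ k"]
        by (simp add: n basis_deriv_def norm_mult norm_power)
      also have "\<dots> \<le> (2 * E) * (real k * r ^ (2 * k) / r\<^sup>2) * E + r ^ (2 * k)"
        using lead pow[of k] E(2) E0 kr by (intro add_mono mult_mono) auto
      also have "\<dots> = (E\<^sup>2 / r ^ 3) * (real (2 * k) * r ^ n) + (1 / r) * (1 * r ^ n)"
        using r by (simp add: n field_simps power2_eq_square power3_eq_cube)
      also have "\<dots> \<le> (E\<^sup>2 / r ^ 3) * (real (Suc n) * r ^ n) + (1 / r) * (real (Suc n) * r ^ n)"
        using r by (intro add_mono mult_left_mono mult_right_mono) (auto simp: n)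
      also have "\<dots> = (E\<^sup>2 / r ^ 3 + 1 / r) * (real (Suc n) * r ^ n)"
        by (simp add: algebra_simps)
      also have "\<dots> \<le> B * (real (Suc n) * r ^ n)"
        using B r by (intro mult_right_mono) auto
      finally show ?thesis .
    qed
    then show "norm (basis_deriv n q * a n) \<le> B * (real (Suc n) * r ^ n * norm (a n))"
      unfolding norm_mult by (metis mult.assoc mult_right_mono norm_ge_zero)
  qed
qed

text \<open>
  The majorant is valid on an open neighbourhood of \<open>K\<close>: the same fact serves the
  uniform convergence on \<open>K\<close> and, for a single point, term-by-term differentiation around it.
\<close>

lemma compact_majorant:
  assumes K: "compact K" "K \<subseteq> U"
  obtains M N where "summable M" "open N" "K \<subseteq> N"
    "\<forall>q\<in>N. \<forall>n. norm (basis n q * a n) \<le> M n \<and> norm (basis_deriv n q * a n) \<le> M n"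
proof (cases "K = {}")
  case True
  then show ?thesis by (intro that[of "\<lambda>_. 0" "{}"]) auto
next
  case False
  obtain p where p: "p \<in> K" "\<And>q. q \<in> K \<Longrightarrow> norm (sphere_poly q) \<le> norm (sphere_poly p)"
  proof -
    have "continuous_on K (\<lambda>q. norm (sphere_poly q))" by (intro continuous_intros)
    then show ?thesis
      using continuous_attains_sup[OF K(1) False, of "\<lambda>q. norm (sphere_poly q)"] that by blast
  qed
  then have "sqrt (norm (sphere_poly p)) < R"
    using K R_pos by (auto simp: U_eq intro: real_less_lsqrt)
  then obtain r where r: "sqrt (norm (sphere_poly p)) < r" "r < R" using dense by blast
  then have r0: "0 < r" using order_le_less_trans[OF real_sqrt_ge_zero[OF norm_ge_zero]] by blast
  have wp: "norm (sphere_poly p) < r\<^sup>2"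
    using r(1) r0 real_sqrt_less_iff[of "norm (sphere_poly p)" "r\<^sup>2"] by simp
  obtain C where C: "\<And>q. q \<in> K \<Longrightarrow> norm q < C"
    using compact_imp_bounded[OF K(1)] by (auto simp: bounded_pos_less)
  obtain M where M: "summable M"
    "\<And>n q. norm (sphere_poly q) \<le> r\<^sup>2 \<Longrightarrow> norm q \<le> C \<Longrightarrow> norm (basis n q * a n) \<le> M n"
    "\<And>n q. norm (sphere_poly q) \<le> r\<^sup>2 \<Longrightarrow> norm q \<le> C \<Longrightarrow> norm (basis_deriv n q * a n) \<le> M n"
    using norm_terms_majorant[OF r0 r(2)] by blast
  have "open {q. norm (sphere_poly q) < r\<^sup>2 \<and> norm q < C}"
    by (intro open_Collect_conj open_Collect_less continuous_intros)
  moreover have "K \<subseteq> {q. norm (sphere_poly q) < r\<^sup>2 \<and> norm q < C}"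
    using C p(2) wp by (auto intro: order_le_less_trans)
  ultimately show ?thesis
    by (intro that[OF M(1)]) (auto intro!: M(2,3))
qed

lemma uniform_limit_on_compact:
  assumes K: "compact K" "K \<subseteq> U"
  shows "uniform_limit K (\<lambda>N q. \<Sum>n<N. basis n q * a n) (\<lambda>q. \<Sum>n. basis n q * a n) sequentially"
proof -
  obtain M N where N: "summable M" "open N" "K \<subseteq> N"
    "\<forall>q\<in>N. \<forall>n. norm (basis n q * a n) \<le> M n \<and> norm (basis_deriv n q * a n) \<le> M n"
    using compact_majorant[OF K] by blast
  show ?thesis
    by (rule Weierstrass_m_test[OF _ N(1)]) (use N(3,4) in blast)
qed

lemma summable_norm_on_compact:
  assumes K: "compact K" "K \<subseteq> U" and q: "q \<in> K"
  shows "summable (\<lambda>n. norm (basis n q * a n))"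
proof -
  obtain M N where N: "summable M" "open N" "K \<subseteq> N"
    "\<forall>q\<in>N. \<forall>n. norm (basis n q * a n) \<le> M n \<and> norm (basis_deriv n q * a n) \<le> M n"
    using compact_majorant[OF K] by blast
  have "norm (basis n q * a n) \<le> M n" for n
    using N(3,4) q by blast
  then show ?thesis
    by (intro summable_comparison_test'[OF N(1)]) simp
qed

section \<open>Regularity of the sum\<close>

definition series :: "quat \<Rightarrow> quat" where "series q = (\<Sum>n. basis n q * a n)"

definition series_deriv :: "quat \<Rightarrow> quat" where "series_deriv q = (\<Sum>n. basis_deriv n q * a n)"

lemma point_majorant:
  assumes "q \<in> U"
  obtains M N where "summable M" "open N" "q \<in> N"
    "\<forall>q\<in>N. \<forall>n. norm (basis n q * a n) \<le> M n \<and> norm (basis_deriv n q * a n) \<le> M n"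
proof -
  have K: "compact {q}" "{q} \<subseteq> U" using assms by auto
  obtain M N where "summable M" "open N" "{q} \<subseteq> N"
    "\<forall>q\<in>N. \<forall>n. norm (basis n q * a n) \<le> M n \<and> norm (basis_deriv n q * a n) \<le> M n"
    using compact_majorant[OF K] by blast
  then show ?thesis
    using that by simp
qed

lemma continuous_on_series_deriv: "continuous_on U series_deriv"
  unfolding continuous_on_eq_continuous_at[OF open_U]
proof
  fix q assume q: "q \<in> U"
  obtain M N where N: "summable M" "open N" "q \<in> N"
    "\<forall>q\<in>N. \<forall>n. norm (basis n q * a n) \<le> M n \<and> norm (basis_deriv n q * a n) \<le> M n"
    using point_majorant[OF q] by blast
  have bound: "norm (basis_deriv n q * a n) \<le> M n" if "q \<in> N" for n q
    using N(4) that by blast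
  have "continuous_on N series_deriv"
    unfolding series_deriv_def
    by (rule uniform_limit_theorem[OF _ Weierstrass_m_test[OF bound N(1)]])
       (auto intro!: always_eventually continuous_intros continuous_on_basis_deriv)
  then show "isCont series_deriv q"
    using N(2,3) by (simp add: continuous_on_eq_continuous_at)
qed

text \<open>
  The sum inherits from its terms that the derivative in a direction \<open>d\<close> commuting with the base
  point is left multiplication by \<open>d\<close> of a function independent of \<open>d\<close>. Used with \<open>d = 1\<close> and \<open>d = J\<close>,
  this is the Cauchy-Riemann equation in the slice of \<open>J\<close>.
\<close>

lemma series_has_vector_derivative:
  assumes comm: "p * d = d * p" and U: "p + t *\<^sub>R d \<in> U"
  shows "((\<lambda>s. series (p + s *\<^sub>R d)) has_vector_derivative d * series_deriv (p + t *\<^sub>R d)) (at t)"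
proof -
  obtain M N where N: "summable M" "open N" "p + t *\<^sub>R d \<in> N"
    "\<forall>q\<in>N. \<forall>n. norm (basis n q * a n) \<le> M n \<and> norm (basis_deriv n q * a n) \<le> M n"
    using point_majorant[OF U] by blast
  have "open ((\<lambda>s. p + s *\<^sub>R d) -` N)"
    by (intro open_vimage N continuous_intros)
  then obtain e where e: "e > 0" "ball t e \<subseteq> (\<lambda>s. p + s *\<^sub>R d) -` N"
    using N(3) unfolding open_contains_ball by blast
  have "((\<lambda>s. \<Sum>n. basis n (p + s *\<^sub>R d) * a n) has_vector_derivative
      (\<Sum>n. d * basis_deriv n (p + t *\<^sub>R d) * a n)) (at t)"
  proof (rule has_vector_derivative_suminf_M_test[where S = "ball t e" and M = "\<lambda>n. norm d * M n"])
    fix n s assume "s \<in> ball t e"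
    then have s: "p + s *\<^sub>R d \<in> N" using e by auto
    show "norm (d * basis_deriv n (p + s *\<^sub>R d) * a n) \<le> norm d * M n"
      using N(4) s by (simp add: norm_mult mult.assoc mult_left_mono)
    show "((\<lambda>s. basis n (p + s *\<^sub>R d) * a n) has_vector_derivative
        d * basis_deriv n (p + s *\<^sub>R d) * a n) (at s)"
      by (intro has_vector_derivative_mult_left basis_has_vector_derivative comm)
  next
    fix s assume "s \<in> ball t e"
    then have s: "p + s *\<^sub>R d \<in> N" using e by auto
    show "summable (\<lambda>n. basis n (p + s *\<^sub>R d) * a n)"
      by (rule summable_comparison_test'[OF N(1)]) (use N(4) s in blast)
  qed (use e N(1) in \<open>auto intro: summable_mult\<close>)
  moreover have "(\<Sum>n. d * basis_deriv n (p + t *\<^sub>R d) * a n) = d * series_deriv (p + t *\<^sub>R d)"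
    unfolding series_deriv_def mult.assoc
    by (intro suminf_mult summable_comparison_test'[OF N(1)]) (use N(3,4) in blast)
  ultimately show ?thesis
    by (simp add: series_def)
qed

lemma slice_regular_series: "slice_regular_on U series"
  unfolding slice_regular_on_def
proof (intro conjI ballI open_U)
  fix J assume "J \<in> imaginary_units"
  then have J: "J * (J * c) = - c" for c
    by (simp add: imaginary_units_def power2_eq_square mult.assoc[symmetric])
  define D where "D = {(x, y). of_real x + J * of_real y \<in> U}"
  define F where "F = (\<lambda>(x, y). series_deriv (of_real x + J * of_real y))"
  have cont: "continuous_on D F"
    unfolding F_def case_prod_unfold D_def
    by (rule continuous_on_compose2[OF continuous_on_series_deriv]) (auto intro!: continuous_intros)
  have dx: "((\<lambda>s. series (of_real s + J * of_real y)) has_vector_derivative F (x, y)) (at x)"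
    if "(x, y) \<in> D" for x y
    using series_has_vector_derivative[of "J * of_real y" 1 x] that
    by (simp add: D_def F_def scaleR_conv_of_real add.commute)
  have dy: "((\<lambda>t. series (of_real x + J * of_real t)) has_vector_derivative J * F (x, y)) (at y)"
    if "(x, y) \<in> D" for x y
    using series_has_vector_derivative[of "of_real x" J y] that
    by (simp add: D_def F_def scaleR_conv_of_real of_real_commute)
  have "continuous_on D (\<lambda>z. J * F z)"
    by (intro continuous_intros cont)
  then show "slice_holomorphic_on J U series"
    unfolding slice_holomorphic_on_def Let_def D_def[symmetric]
    by (intro exI[of _ F] exI[of _ "\<lambda>z. J * F z"]) (auto simp: cont dx dy J)
qed

section \<open>Divergence outside the closure\<close>

text \<open>
  The minimum modulus principle for the sphere polynomial \<open>w\<close>, by explicit perturbations.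
  Put \<open>z = q - x\<^sub>0\<close>. If \<open>z \<noteq> 0\<close>, one Newton step towards a zero of \<open>w\<close> is \<open>- w(q) / (2 z)\<close>; a small positive
  multiple \<open>- t z\<^bsup>-1\<^esup> w(q)\<close> of it replaces \<open>w(q)\<close> by \<open>(1 - 2 t) w(q) + O(t\<^sup>2)\<close>. If \<open>z = 0\<close>, then
  \<open>w(q) = y\<^sub>0\<^sup>2\<close>, and a small imaginary step \<open>s i\<close> subtracts \<open>s\<^sup>2\<close> from it.
\<close>

lemma norm_sphere_poly_decreases_nearby:
  assumes "sphere_poly q \<noteq> 0" "y\<^sub>0 > 0" "e > 0"
  obtains p where "dist p q < e" "norm (sphere_poly p) < norm (sphere_poly q)"
proof (cases "q = of_real x\<^sub>0")
  case True
  define s where "s = min (e / 2) y\<^sub>0"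
  have s: "0 < s" "s < e" "s \<le> y\<^sub>0" using assms by (auto simp: s_def)
  define h where "h = Quat 0 s 0 0"
  have "h\<^sup>2 = of_real (- s\<^sup>2)"
    by (simp add: h_def quat_eq_iff power2_eq_square of_real_def)
  then have "sphere_poly (q + h) = of_real (y\<^sub>0\<^sup>2 - s\<^sup>2)"
    by (simp add: sphere_poly_def True)
  moreover have "sphere_poly q = of_real (y\<^sub>0\<^sup>2)" by (simp add: sphere_poly_def True)
  ultimately have "norm (sphere_poly (q + h)) < norm (sphere_poly q)"
    using s power_mono[of s y\<^sub>0 2] by (simp only: norm_of_real) auto
  moreover have "dist (q + h) q < e"
    using s by (simp add: dist_norm h_def norm_quat_def)
  ultimately show ?thesis using that by blast
next
  case False
  define z where "z = q - of_real x\<^sub>0"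
  define u where "u = inverse z * sphere_poly q"
  define c where "c = norm (sphere_poly q) / (norm z)\<^sup>2"
  have z: "z \<noteq> 0" using False by (simp add: z_def)
  have wz: "sphere_poly q = z\<^sup>2 + (of_real y\<^sub>0)\<^sup>2" by (simp add: sphere_poly_def z_def)
  have "sphere_poly q * z = z * sphere_poly q"
    by (rule sphere_poly_commute) (simp add: z_def)
  then have uz: "u * z = sphere_poly q"
    using z by (simp only: u_def mult.assoc) (simp add: mult.assoc[symmetric])
  have zu: "z * u = sphere_poly q"
    using z by (simp add: u_def mult.assoc[symmetric])
  have u: "u \<noteq> 0" using zu assms(1) by auto
  have c0: "c > 0" using z assms(1) by (simp add: c_def)
  have nu: "norm (u\<^sup>2) = c * norm (sphere_poly q)"
    by (simp add: u_def c_def norm_mult norm_power norm_inverse power2_eq_square divide_inverse)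
  \<comment> \<open>The bound \<open>t \<le> 1/2\<close> keeps \<open>1 - 2 t\<close> nonnegative, \<open>t \<le> 1/c\<close> makes the quadratic term at most
      half of the linear gain, and the last bound keeps the step shorter than \<open>e\<close>.\<close>
  define t where "t = min (1 / 2) (min (1 / c) (e / (2 * norm u)))"
  have t: "0 < t" "t \<le> 1 / 2" "t \<le> 1 / c" "t \<le> e / (2 * norm u)"
    using c0 u assms(3) by (auto simp: t_def)
  have "sphere_poly (q - t *\<^sub>R u) = (z - t *\<^sub>R u)\<^sup>2 + (of_real y\<^sub>0)\<^sup>2"
    by (simp add: sphere_poly_def z_def algebra_simps)
  also have "\<dots> = (1 - 2 * t) *\<^sub>R sphere_poly q + t\<^sup>2 *\<^sub>R u\<^sup>2"
  proof -
    have "(z - t *\<^sub>R u)\<^sup>2 = z\<^sup>2 - z * (t *\<^sub>R u) - (t *\<^sub>R u) * z + (t *\<^sub>R u) * (t *\<^sub>R u)"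
      unfolding power2_eq_square left_diff_distrib right_diff_distrib by simp
    also have "\<dots> = z\<^sup>2 - (2 * t) *\<^sub>R sphere_poly q + t\<^sup>2 *\<^sub>R u\<^sup>2"
      unfolding mult_scaleR_left mult_scaleR_right zu uz mult_2 scaleR_add_left
      by (simp add: power2_eq_square)
    finally show ?thesis
      unfolding wz scaleR_diff_left by simp
  qed
  finally have "norm (sphere_poly (q - t *\<^sub>R u)) \<le> (1 - 2 * t) * norm (sphere_poly q) + t\<^sup>2 * (c * norm (sphere_poly q))"
    using t norm_triangle_ineq[of "(1 - 2 * t) *\<^sub>R sphere_poly q" "t\<^sup>2 *\<^sub>R u\<^sup>2"] nu by simp
  also have "\<dots> = (1 - 2 * t + t * (t * c)) * norm (sphere_poly q)"
    by (simp add: algebra_simps power2_eq_square)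
  also have "\<dots> < 1 * norm (sphere_poly q)"
  proof (intro mult_strict_right_mono)
    have "t * c \<le> 1" using t(3) c0 by (simp add: field_simps)
    then have "t * (t * c) \<le> t * 1" using t by (intro mult_left_mono) auto
    then show "1 - 2 * t + t * (t * c) < 1" using t by simp
  qed (use assms in simp)
  finally have "norm (sphere_poly (q - t *\<^sub>R u)) < norm (sphere_poly q)" by simp
  moreover have "t * norm u < e" using t(1,4) u assms(3) by (simp add: field_simps)
  then have "dist (q - t *\<^sub>R u) q < e" using t by (simp add: dist_norm)
  ultimately show ?thesis using that by blast
qed

lemma norm_sphere_poly_gt_outside_closure:
  assumes "q \<notin> closure U" "y\<^sub>0 > 0"
  shows "norm (sphere_poly q) > R\<^sup>2"
proof (rule ccontr)
  assume "\<not> norm (sphere_poly q) > R\<^sup>2"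
  then have le: "norm (sphere_poly q) \<le> R\<^sup>2" by simp
  have "q \<notin> U" using assms closure_subset by blast
  then have "sphere_poly q \<noteq> 0" using R_pos by (auto simp: U_eq)
  have "\<exists>p\<in>U. dist p q < e" if "e > 0" for e
    using norm_sphere_poly_decreases_nearby[OF \<open>sphere_poly q \<noteq> 0\<close> assms(2) that] le
    by (metis (mono_tags) U_eq mem_Collect_eq order_less_le_trans)
  then show False
    using assms(1) by (simp add: closure_approachable)
qed

text \<open>
  The hypothesis that \<open>q\<^sub>0\<close> is a zero of the sphere polynomial ensures \<open>q \<noteq> q\<^sub>0\<close>, so that the odd
  basis polynomials also have modulus comparable to \<open>r\<^sup>n\<close> from below. The lower bound is needed for both
  parities because the upper limit may be attained along either of them.
\<close>

lemma not_summable_outside: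
  assumes large: "norm (sphere_poly q) > R\<^sup>2" and q0: "sphere_poly q\<^sub>0 = 0"
  shows "\<not> summable (\<lambda>n. basis n q * a n)"
proof
  assume "summable (\<lambda>n. basis n q * a n)"
  then have lim: "(\<lambda>n. norm (basis n q * a n)) \<longlonglongrightarrow> 0"
    using summable_LIMSEQ_zero tendsto_norm_zero by blast
  define r where "r = sqrt (norm (sphere_poly q))"
  have r2: "r\<^sup>2 = norm (sphere_poly q)" by (simp add: r_def)
  have rR: "R < r" unfolding r_def by (rule real_less_rsqrt[OF large])
  have r0: "0 < r" using rR R_pos by simp
  have "q \<noteq> q\<^sub>0" using large q0 by auto
  define c where "c = min 1 (norm (q - q\<^sub>0) / r)"
  have c0: "c > 0" using r0 \<open>q \<noteq> q\<^sub>0\<close> by (simp add: c_def)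
  have lower: "c * r ^ n \<le> norm (basis n q)" for n
  proof (cases "even n")
    case True
    then obtain k where "n = 2 * k" by blast
    then have "norm (basis n q) = 1 * r ^ n"
      by (simp add: basis_def norm_power r2[symmetric] power_mult)
    moreover have "c * r ^ n \<le> 1 * r ^ n"
      using r0 by (intro mult_right_mono) (auto simp: c_def)
    ultimately show ?thesis by simp
  next
    case False
    then obtain k where "n = 2 * k + 1" using oddE by blast
    then have "norm (basis n q) = norm (q - q\<^sub>0) / r * r ^ n"
      using r0 by (simp add: basis_def norm_mult norm_power r2[symmetric] power_mult)
    moreover have "c * r ^ n \<le> norm (q - q\<^sub>0) / r * r ^ n"
      using r0 by (intro mult_right_mono) (auto simp: c_def)
    ultimately show ?thesis by simp
  qed
  have "\<forall>\<^sub>F n in sequentially. norm (basis n q * a n) < c"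
    by (rule order_tendstoD(2)[OF lim c0])
  then have "\<forall>\<^sub>F n in sequentially. ereal (root n (norm (a n))) \<le> ereal (1 / r)"
    using eventually_gt_at_top[of 0]
  proof eventually_elim
    case (elim n)
    have "c * (r ^ n * norm (a n)) \<le> norm (basis n q * a n)"
      using mult_right_mono[OF lower[of n], of "norm (a n)"] by (simp add: norm_mult mult.assoc)
    also have "\<dots> \<le> c * 1" using elim by simp
    finally have "r ^ n * norm (a n) \<le> 1" using c0 by simp
    then have "norm (a n) \<le> (1 / r) ^ n"
      using r0 by (simp add: field_simps)
    then have "root n (norm (a n)) \<le> root n ((1 / r) ^ n)"
      using elim by simp
    also have "\<dots> = 1 / r"
      using elim r0 by (intro real_root_power_cancel) auto
    finally show ?case by simp
  qed
  then have "ereal (1 / R) \<le> ereal (1 / r)"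
    unfolding limsup_root[symmetric] by (rule Limsup_bounded)
  then show False
    using rR R_pos r0 by (simp add: field_simps)
qed

end

theorem proposition1p11:
  fixes a :: "nat \<Rightarrow> quat" and R x\<^sub>0 y\<^sub>0 :: real and I q\<^sub>0 :: quat
    and P :: "nat \<Rightarrow> quat \<Rightarrow> quat"
  assumes "R > 0"
    and "limsup (\<lambda>n. ereal (root n (norm (a n)))) = ereal (1 / R)"
    and "y\<^sub>0 > 0"
    and "I \<in> imaginary_units"
    and "q\<^sub>0 = of_real x\<^sub>0 + I * of_real y\<^sub>0"
    and "\<And>n q. P (2 * n) q = ((q - of_real x\<^sub>0)\<^sup>2 + (of_real y\<^sub>0)\<^sup>2) ^ n"
    and "\<And>n q. P (2 * n + 1) q = ((q - of_real x\<^sub>0)\<^sup>2 + (of_real y\<^sub>0)\<^sup>2) ^ n * (q - q\<^sub>0)"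
  shows "(\<forall>K. compact K \<and> K \<subseteq> sphere_nbhd x\<^sub>0 y\<^sub>0 R \<longrightarrow>
            (\<forall>q\<in>K. summable (\<lambda>n. norm (P n q * a n))) \<and>
            uniform_limit K (\<lambda>N q. \<Sum>n<N. P n q * a n) (\<lambda>q. \<Sum>n. P n q * a n) sequentially) \<and>
         slice_regular_on (sphere_nbhd x\<^sub>0 y\<^sub>0 R) (\<lambda>q. \<Sum>n. P n q * a n) \<and>
         (\<forall>q. q \<notin> closure (sphere_nbhd x\<^sub>0 y\<^sub>0 R) \<longrightarrow> \<not> summable (\<lambda>n. P n q * a n))"
proof -
  interpret spherical_series x\<^sub>0 y\<^sub>0 R q\<^sub>0 a
    by standard (fact assms)+
  have P: "P n q = basis n q" for n q
  proof (cases "even n")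
    case True
    then show ?thesis using assms(6)[of "n div 2" q] by (simp add: basis_def sphere_poly_def)
  next
    case False
    then show ?thesis using assms(7)[of "n div 2" q] by (simp add: basis_def sphere_poly_def)
  qed
  have "I * of_real y\<^sub>0 * (I * of_real y\<^sub>0) = I * (of_real y\<^sub>0 * I) * of_real y\<^sub>0"
    by (simp only: mult.assoc)
  also have "\<dots> = I * I * (of_real y\<^sub>0 * of_real y\<^sub>0)"
    by (simp only: of_real_commute[of y\<^sub>0 I] mult.assoc)
  finally have "sphere_poly q\<^sub>0 = I\<^sup>2 * (of_real y\<^sub>0)\<^sup>2 + (of_real y\<^sub>0)\<^sup>2"
    unfolding sphere_poly_def assms(5) by (simp add: power2_eq_square)
  then have q0: "sphere_poly q\<^sub>0 = 0"
    using assms(4) by (simp add: imaginary_units_def)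
  have "\<forall>K. compact K \<and> K \<subseteq> U \<longrightarrow> (\<forall>q\<in>K. summable (\<lambda>n. norm (basis n q * a n))) \<and>
      uniform_limit K (\<lambda>N q. \<Sum>n<N. basis n q * a n) (\<lambda>q. \<Sum>n. basis n q * a n) sequentially"
    by (intro allI impI conjI ballI, elim conjE, rule summable_norm_on_compact)
       (auto intro: uniform_limit_on_compact)
  moreover have "\<forall>q. q \<notin> closure U \<longrightarrow> \<not> summable (\<lambda>n. basis n q * a n)"
    using not_summable_outside[OF norm_sphere_poly_gt_outside_closure[OF _ assms(3)] q0] by blast
  ultimately show ?thesis
    unfolding P using slice_regular_series[unfolded series_def] by (intro conjI)
qed

end
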